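(* Let $n$ be a positive integer, let $\mathcal{A}$ and $\mathcal{B}$ be unital Banach algebras, and let $\varphi:\mathcal{A}\to\mathcal{B}$ be a unital mixed $(n+1)$-Jordan homomorphism. Then $\varphi$ is a mixed $n$-Jordan homomorphism.
   Context: Banach algebras are complex and associative. For a positive integer $m$, a mixed $m$-Jordan homomorphism is a linear map $\varphi:\mathcal{A}\to\mathcal{B}$ with $\varphi(a^m b)=\varphi(a)^m\varphi(b)$ for all $a,b\in\mathcal{A}$. A linear map between unital Banach algebras is unital if it maps the unit of $\mathcal{A}$ to the unit of $\mathcal{B}$. *)

theory Defs
  imports "HOL-Analysis.Analysis"
begin

text \<open>
  The real structure inherited from \<^class>\<open>real_normed_algebra\<close> is the restriction of the
  complex one. Completeness comes from \<^class>\<open>banach\<close>.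
\<close>

class complex_banach_algebra = real_normed_algebra + banach +
  fixes scaleC :: "complex \<Rightarrow> 'a \<Rightarrow> 'a"  (infixr \<open>*\<^sub>C\<close> 75)
  assumes scaleC_add_right: "c *\<^sub>C (x + y) = c *\<^sub>C x + c *\<^sub>C y"
    and scaleC_add_left: "(c + d) *\<^sub>C x = c *\<^sub>C x + d *\<^sub>C x"
    and scaleC_scaleC: "c *\<^sub>C d *\<^sub>C x = (c * d) *\<^sub>C x"
    and scaleC_one: "1 *\<^sub>C x = x"
    and scaleR_scaleC: "r *\<^sub>R x = complex_of_real r *\<^sub>C x"
    and mult_scaleC_left: "(c *\<^sub>C x) * y = c *\<^sub>C (x * y)"
    and mult_scaleC_right: "x * (c *\<^sub>C y) = c *\<^sub>C (x * y)"
    and norm_scaleC: "norm (c *\<^sub>C x) = cmod c * norm x"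

text \<open>
  The unit is added through \<^class>\<open>monoid_mult\<close> rather than \<^class>\<open>real_normed_algebra_1\<close>, so that
  neither \<open>norm 1 = 1\<close> nor \<open>0 \<noteq> 1\<close> is imposed.
\<close>

class complex_unital_banach_algebra = complex_banach_algebra + monoid_mult

lemma vector_space_scaleC:
  "vector_space (scaleC :: complex \<Rightarrow> 'a \<Rightarrow> 'a::complex_banach_algebra)"
  by unfold_locales
    (simp_all add: scaleC_add_right scaleC_add_left scaleC_scaleC scaleC_one)

instantiation complex :: complex_unital_banach_algebra
begin

definition scaleC_complex :: "complex \<Rightarrow> complex \<Rightarrow> complex"
  where "scaleC_complex c x = c * x"

instance
  by standard
    (simp_all add: scaleC_complex_def algebra_simps scaleR_conv_of_real norm_mult)

end

definition mixed_jordan_hom ::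
    "nat \<Rightarrow> ('a::complex_unital_banach_algebra \<Rightarrow> 'b::complex_unital_banach_algebra) \<Rightarrow> bool"
  where "mixed_jordan_hom m \<phi> \<longleftrightarrow>
    Vector_Spaces.linear scaleC scaleC \<phi> \<and> (\<forall>a b. \<phi> (a ^ m * b) = \<phi> a ^ m * \<phi> b)"

definition unital_map ::
    "('a::complex_unital_banach_algebra \<Rightarrow> 'b::complex_unital_banach_algebra) \<Rightarrow> bool"
  where "unital_map \<phi> \<longleftrightarrow> \<phi> 1 = 1"

end

theory Submission
  imports Defs
begin

text \<open>
  A unital mixed \<open>m\<close>-Jordan homomorphism with \<open>m \<ge> 1\<close> is multiplicative, and a multiplicative
  linear map is a mixed \<open>n\<close>-Jordan homomorphism for every \<open>n\<close>. Multiplicativity comes from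
  polarisation at the unit: replace \<open>a\<close> by \<open>1 + t a\<close> with \<open>t\<close> real. Since \<open>\<phi>\<close> is linear and
  unital, the defining identity becomes
  \<open>(\<Sum>k\<le>m. (m choose k) t^k (\<phi> (a^k b) - \<phi> (a)^k \<phi> (b))) = 0\<close>
  for all real \<open>t\<close>. A polynomial with vector coefficients that vanishes on the real line
  has zero linear coefficient, which here is \<open>m\<close> times \<open>\<phi>(a b) - \<phi>(a) \<phi>(b)\<close>.
  Only finitely many fixed vectors occur as coefficients, so \<open>\<phi>\<close> may be discontinuous.
\<close>

text \<open>
  The binomial theorem for commuting elements is needed here with one of the two equal to the unit.
  The coefficients are real scalars because the zero algebra is admitted, whereas
  \<^const>\<open>of_nat\<close> requires \<open>0 \<noteq> 1\<close>.
\<close>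

lemma one_plus_power_eq_sum:
  fixes x :: "'a::complex_unital_banach_algebra"
  shows "(1 + x) ^ m = (\<Sum>k\<le>m. real (m choose k) *\<^sub>R x ^ k)"
proof (induction m)
  case 0
  then show ?case by simp
next
  case (Suc m)
  let ?c = "\<lambda>k. real (m choose k)"
  have shift: "(\<Sum>k\<le>m. ?c k *\<^sub>R x ^ k) = 1 + (\<Sum>k\<le>m. ?c (Suc k) *\<^sub>R x ^ Suc k)"
  proof -
    have "(\<Sum>k\<le>m. ?c k *\<^sub>R x ^ k) = (\<Sum>k\<le>Suc m. ?c k *\<^sub>R x ^ k)"
      by simp
    also have "\<dots> = 1 + (\<Sum>k\<le>m. ?c (Suc k) *\<^sub>R x ^ Suc k)"
      by (subst sum.atMost_Suc_shift) simp
    finally show ?thesis .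
  qed
  have "(1 + x) ^ Suc m = (\<Sum>k\<le>m. ?c k *\<^sub>R x ^ k) + (\<Sum>k\<le>m. ?c k *\<^sub>R x ^ Suc k)"
    by (simp add: Suc.IH distrib_right sum_distrib_left scaleR_add_right sum.distrib)
  also have "\<dots> = 1 + (\<Sum>k\<le>m. real (Suc m choose Suc k) *\<^sub>R x ^ Suc k)"
    by (subst shift) (simp add: sum.distrib scaleR_add_left add.assoc add.commute)
  also have "\<dots> = (\<Sum>k\<le>Suc m. real (Suc m choose k) *\<^sub>R x ^ k)"
    by (subst sum.atMost_Suc_shift) simp
  finally show ?case .
qed

text \<open>The linear coefficient is the derivative at \<open>0\<close>, and the derivative of \<open>0\<close> is \<open>0\<close>.\<close>

lemma linear_coefficient_eq_zero:
  fixes c :: "nat \<Rightarrow> 'a::real_normed_vector"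
  assumes vanish: "\<And>t::real. (\<Sum>k\<le>m. t ^ k *\<^sub>R c k) = 0" and "m \<ge> 1"
  shows "c 1 = 0"
proof -
  have "((\<lambda>t::real. \<Sum>k\<le>m. t ^ k *\<^sub>R c k) has_vector_derivative
      (\<Sum>k\<le>m. (real k * 0 ^ (k - 1)) *\<^sub>R c k)) (at 0)"
    by (auto intro!: derivative_eq_intros has_vector_derivative_sum)
  moreover have "(\<Sum>k\<le>m. (real k * 0 ^ (k - 1)) *\<^sub>R c k) = (\<Sum>k\<in>{1}. c k)"
    using \<open>m \<ge> 1\<close> by (intro sum.mono_neutral_cong_right) (auto simp: power_0_left)
  ultimately have "((\<lambda>t::real. 0) has_vector_derivative c 1) (at 0)"
    by (simp add: vanish)
  then show ?thesis
    using has_vector_derivative_const vector_derivative_unique_at by blast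
qed

lemma unital_mixed_jordan_hom_multiplicative:
  fixes \<phi> :: "'a::complex_unital_banach_algebra \<Rightarrow> 'b::complex_unital_banach_algebra"
  assumes "mixed_jordan_hom m \<phi>" and "unital_map \<phi>" and "m \<ge> 1"
  shows "\<phi> (a * b) = \<phi> a * \<phi> b"
proof -
  have lin: "Vector_Spaces.linear scaleC scaleC \<phi>"
    and jordan: "\<And>a b. \<phi> (a ^ m * b) = \<phi> a ^ m * \<phi> b"
    using assms(1) by (auto simp: mixed_jordan_hom_def)
  have one: "\<phi> 1 = 1"
    using assms(2) by (simp add: unital_map_def)
  interpret Vector_Spaces.linear "scaleC :: complex \<Rightarrow> 'a \<Rightarrow> 'a" "scaleC :: complex \<Rightarrow> 'b \<Rightarrow> 'b" \<phi>
    by (fact lin)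
  have scaleR: "\<phi> (r *\<^sub>R x) = r *\<^sub>R \<phi> x" for r x
    by (simp add: scaleR_scaleC scale)
  have power_scaleR: "(t *\<^sub>R x) ^ k = t ^ k *\<^sub>R x ^ k"
    for t :: real and x :: "'c::complex_unital_banach_algebra" and k
    by (induction k) simp_all
  define c where "c k = real (m choose k) *\<^sub>R (\<phi> (a ^ k * b) - \<phi> a ^ k * \<phi> b)" for k
  have "(\<Sum>k\<le>m. t ^ k *\<^sub>R c k) = 0" for t :: real
  proof -
    have "\<phi> ((1 + t *\<^sub>R a) ^ m * b) = (\<Sum>k\<le>m. (real (m choose k) * t ^ k) *\<^sub>R \<phi> (a ^ k * b))"
      by (simp add: one_plus_power_eq_sum power_scaleR sum_distrib_right sum scaleR)
    moreover have "\<phi> (1 + t *\<^sub>R a) ^ m * \<phi> b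
        = (\<Sum>k\<le>m. (real (m choose k) * t ^ k) *\<^sub>R (\<phi> a ^ k * \<phi> b))"
      by (simp add: add one scaleR one_plus_power_eq_sum power_scaleR sum_distrib_right)
    ultimately show ?thesis
      using jordan[of "1 + t *\<^sub>R a" b]
      by (simp add: c_def scaleR_diff_right sum_subtractf mult.commute)
  qed
  then have "c 1 = 0"
    using \<open>m \<ge> 1\<close> by (rule linear_coefficient_eq_zero)
  then show ?thesis
    using \<open>m \<ge> 1\<close> by (simp add: c_def)
qed

theorem corollary2p14:
  fixes n :: nat
    and \<phi> :: "'a::complex_unital_banach_algebra \<Rightarrow> 'b::complex_unital_banach_algebra"
  assumes "n \<ge> 1"
    and "mixed_jordan_hom (n + 1) \<phi>"
    and "unital_map \<phi>"
  shows "mixed_jordan_hom n \<phi>"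
proof -
  have mult: "\<phi> (a * b) = \<phi> a * \<phi> b" for a b
    using assms(2,3) by (rule unital_mixed_jordan_hom_multiplicative) simp
  have "\<phi> (a ^ n * b) = \<phi> a ^ n * \<phi> b" for a b
    by (induction n) (simp_all add: mult mult.assoc)
  then show ?thesis
    using assms(2) by (simp add: mixed_jordan_hom_def)
qed

end
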